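(* For every integer $n \geqslant 31$, every integer $k$ with $-n \leqslant k \leqslant n$ is an eigenvalue of (the adjacency matrix of) the Transposition graph $T_n$.
   Context: The Transposition graph $T_n$ is the Cayley graph of the symmetric group $\mathrm{Sym}_n$ with respect to the set of all transpositions: its vertices are the elements of $\mathrm{Sym}_n$, and $g,h$ are adjacent iff $g^{-1}h$ is a transposition. The spectrum of a graph is the multiset of eigenvalues of its adjacency matrix. *)

theory Defs
  imports
    "HOL-Algebra.Sym_Groups"
    "Graph_Theory.Pair_Digraph"
    "Jordan_Normal_Form.Char_Poly"
begin

text \<open>Undirected graphs are represented as symmetric digraphs (locale \<^locale>\<open>pair_graph\<close>).
  The definition below is the Cayley graph in which \<open>g\<close> and \<open>h\<close> are adjacent iff
  \<open>g\<^sup>-\<^sup>1 h \<in> S\<close>; it is undirected and loop-free when \<open>S\<close> is closed under inverses and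
  does not contain the identity.\<close>

definition cayley_graph :: "('a, 'b) monoid_scheme \<Rightarrow> 'a set \<Rightarrow> 'a pair_pre_digraph" where
  "cayley_graph G S =
     \<lparr> pverts = carrier G,
       parcs = {(g, h). g \<in> carrier G \<and> h \<in> carrier G \<and> inv\<^bsub>G\<^esub> g \<otimes>\<^bsub>G\<^esub> h \<in> S} \<rparr>"

definition transpositions :: "nat \<Rightarrow> (nat \<Rightarrow> nat) set" where
  "transpositions n = {Transposition.transpose i j | i j. i \<in> {1..n} \<and> j \<in> {1..n} \<and> i \<noteq> j}"

definition transposition_graph :: "nat \<Rightarrow> (nat \<Rightarrow> nat) pair_pre_digraph" where
  "transposition_graph n = cayley_graph (sym_group n) (transpositions n)"

text \<open>Matrices are indexed by natural numbers, so an adjacency matrix depends on an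
  enumeration of the vertices. Different enumerations give matrices that are conjugate by a
  permutation matrix, and hence have the same eigenvalues.\<close>

definition vertex_enumeration :: "'a pair_pre_digraph \<Rightarrow> 'a list \<Rightarrow> bool" where
  "vertex_enumeration G vs \<longleftrightarrow> distinct vs \<and> set vs = pverts G"

definition adjacency_matrix :: "'a pair_pre_digraph \<Rightarrow> 'a list \<Rightarrow> real mat" where
  "adjacency_matrix G vs =
     mat (length vs) (length vs) (\<lambda>(i, j). if (vs ! i, vs ! j) \<in> parcs G then 1 else 0)"

lemma pair_graph_transposition_graph: "pair_graph (transposition_graph n)"
proof -
  interpret S: group "sym_group n" by (rule sym_group_is_group)
  have fin: "finite (carrier (sym_group n))"
    by (simp add: sym_group_def finite_permutations)
  have inv_closed: "inv\<^bsub>sym_group n\<^esub> t \<in> transpositions n"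
    if "t \<in> transpositions n" "t \<in> carrier (sym_group n)" for t
  proof -
    have "t \<otimes>\<^bsub>sym_group n\<^esub> t = \<one>\<^bsub>sym_group n\<^esub>"
      using that(1) by (auto simp: transpositions_def sym_group_def)
    then have "inv\<^bsub>sym_group n\<^esub> t = t"
      using that(2) by (intro S.inv_equality)
    then show ?thesis using that(1) by simp
  qed
  have one: "\<one>\<^bsub>sym_group n\<^esub> \<notin> transpositions n"
    by (auto simp: transpositions_def sym_group_def fun_eq_iff Transposition.transpose_def)
  have sym: "inv\<^bsub>sym_group n\<^esub> h \<otimes>\<^bsub>sym_group n\<^esub> g \<in> transpositions n"
    if "g \<in> carrier (sym_group n)" "h \<in> carrier (sym_group n)"
      "inv\<^bsub>sym_group n\<^esub> g \<otimes>\<^bsub>sym_group n\<^esub> h \<in> transpositions n" for g h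
  proof -
    have "inv\<^bsub>sym_group n\<^esub> (inv\<^bsub>sym_group n\<^esub> g \<otimes>\<^bsub>sym_group n\<^esub> h) \<in> transpositions n"
      using inv_closed[OF that(3)] that(1,2) by blast
    then show ?thesis
      by (simp only: S.inv_mult_group[OF S.inv_closed[OF that(1)] that(2)] S.inv_inv[OF that(1)])
  qed
  show ?thesis
  proof
    show "finite (pverts (transposition_graph n))"
      using fin by (simp add: transposition_graph_def cayley_graph_def)
    show "finite (parcs (transposition_graph n))"
      by (rule finite_subset[OF _ finite_cartesian_product[OF fin fin]])
         (auto simp: transposition_graph_def cayley_graph_def)
    show "fst e \<in> pverts (transposition_graph n)" if "e \<in> parcs (transposition_graph n)" for e
      using that by (auto simp: transposition_graph_def cayley_graph_def)
    show "snd e \<in> pverts (transposition_graph n)" if "e \<in> parcs (transposition_graph n)" for e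
      using that by (auto simp: transposition_graph_def cayley_graph_def)
    show "fst e \<noteq> snd e" if "e \<in> parcs (transposition_graph n)" for e
      using that one S.l_inv
      by (auto simp: transposition_graph_def cayley_graph_def simp del: sym_group_inv_equality)
    show "symmetric (with_proj (transposition_graph n))"
      using sym
      by (auto simp: symmetric_def transposition_graph_def cayley_graph_def
          arcs_ends_def arc_to_ends_def simp del: sym_group_inv_equality intro!: symI)
  qed
qed

lemma ex_vertex_enumeration: "\<exists>vs. vertex_enumeration (transposition_graph n) vs"
proof -
  interpret pair_graph "transposition_graph n" by (rule pair_graph_transposition_graph)
  show ?thesis
    using finite_distinct_list[OF pair_finite_verts] by (auto simp: vertex_enumeration_def)
qed

end

theory Submission
  imports Defs
begin

text \<open>Every Young diagram \<open>Y\<close> with \<open>n\<close> boxes yields an eigenvalue, namely the sum of the contents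
  (column minus row) of its boxes. Label the boxes bijectively by \<open>1, \<dots>, n\<close> and send a permutation
  \<open>g\<close> to the Specht polynomial of \<open>Y\<close> (the product over the columns of their Vandermonde products)
  evaluated at the permuted labels; this function vanishes nowhere. Swapping two boxes of one column
  changes its sign, and swapping a fixed box with all boxes of an earlier column in turn and adding
  up gives back its value, by Lagrange interpolation. Hence a box in column \<open>c\<close> and row \<open>r\<close>
  contributes \<open>c - r\<close>.

  It remains to find diagrams with \<open>n\<close> boxes and content sum \<open>k\<close>. Surrounding a diagram by a hook
  with arm \<open>a\<close> and leg \<open>b\<close> adds \<open>a + b + 1\<close> boxes and \<open>(a - b) * (a + b + 1) / 2\<close> to the content
  sum. An outer hook of about \<open>n / 2\<close> boxes with \<open>a - b\<close> equal to \<open>0\<close> or \<open>2\<close> reduces \<open>n \<ge> 42\<close> to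
  smaller \<open>n \<ge> 19\<close>, provided that no diagram is wider or higher than \<open>n / 2\<close>.\<close>

section \<open>Specht polynomials\<close>

text \<open>The right-hand side is the value at \<open>y\<close> of a polynomial \<open>q\<close> of
  degree below \<open>card C\<close> that agrees with \<open>p\<close> at \<open>card C\<close>
  distinct nodes, so \<open>p = q\<close>.\<close>

lemma lagrange_interpolation:
  fixes x :: "'a \<Rightarrow> 'b :: field"
  assumes "finite C" "inj_on x C" "degree p < card C"
  shows "poly p y = (\<Sum>i\<in>C. poly p (x i) * (\<Prod>k\<in>C - {i}. (y - x k) / (x i - x k)))"
proof -
  define q where
    "q = (\<Sum>i\<in>C. Polynomial.smult (poly p (x i)) (\<Prod>k\<in>C - {i}. [:- x k / (x i - x k), 1 / (x i - x k):]))"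
  have poly_q: "poly q y = (\<Sum>i\<in>C. poly p (x i) * (\<Prod>k\<in>C - {i}. (y - x k) / (x i - x k)))" for y
    by (simp add: q_def poly_sum poly_prod diff_divide_distrib)
  have "degree q \<le> card C - 1"
    unfolding q_def
  proof (rule degree_sum_le[OF assms(1)])
    fix i assume "i \<in> C"
    have "degree (\<Prod>k\<in>C - {i}. [:- x k / (x i - x k), 1 / (x i - x k):])
        \<le> (\<Sum>k\<in>C - {i}. degree [:- x k / (x i - x k), 1 / (x i - x k):])"
      by (rule order_trans[OF degree_prod_sum_le]) (simp_all add: assms(1) comp_def)
    also have "\<dots> \<le> (\<Sum>k\<in>C - {i}. 1)"
      by (intro sum_mono) simp
    also have "\<dots> = card C - 1" using \<open>i \<in> C\<close> by simp
    finally show "degree (Polynomial.smult (poly p (x i)) (\<Prod>k\<in>C - {i}. [:- x k / (x i - x k), 1 / (x i - x k):]))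
        \<le> card C - 1"
      by (rule order_trans[OF degree_smult_le])
  qed
  then have deg: "degree q < card C" using assms(3) by simp
  have "poly p z = poly q z" if z: "z \<in> x ` C" for z
  proof -
    obtain j where j: "j \<in> C" "z = x j" using z by blast
    have "(\<Prod>k\<in>C - {i}. (x j - x k) / (x i - x k)) = (if i = j then 1 else 0)" if "i \<in> C" for i
    proof (cases "i = j")
      case True
      have "x j \<noteq> x k" if "k \<in> C - {j}" for k
        using that j(1) assms(2) by (auto dest: inj_onD)
      then show ?thesis using True by (auto intro!: prod.neutral)
    next
      case False
      then show ?thesis using j(1) assms(1) by (auto simp: prod_zero_iff)
    qed
    then have "poly q z = (\<Sum>i\<in>C. poly p (x i) * (if i = j then 1 else 0))"
      unfolding poly_q j(2) by (intro sum.cong) auto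
    also have "\<dots> = (\<Sum>i\<in>C. if i = j then poly p (x i) else 0)"
      by (intro sum.cong) auto
    finally show ?thesis using j assms(1) by simp
  qed
  then have "p = q"
    using assms(2,3) deg by (intro poly_eqI_degree[of "x ` C"]) (simp_all add: card_image)
  then show ?thesis unfolding poly_q[of y, symmetric] by simp
qed

section \<open>Specht polynomials and the effect of swapping two boxes\<close>

definition column_pairs :: "(nat \<times> nat) set \<Rightarrow> ((nat \<times> nat) \<times> (nat \<times> nat)) set" where
  "column_pairs S = {(u, v) \<in> S \<times> S. fst u = fst v \<and> snd u < snd v}"

definition specht :: "(nat \<times> nat) set \<Rightarrow> (nat \<times> nat \<Rightarrow> 'b :: field) \<Rightarrow> 'b" where
  "specht S x = (\<Prod>(u, v)\<in>column_pairs S. x v - x u)"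

lemma finite_column_pairs [simp]: "finite S \<Longrightarrow> finite (column_pairs S)"
  by (rule finite_subset[of _ "S \<times> S"]) (auto simp: column_pairs_def)

lemma specht_cong: "(\<And>u. u \<in> S \<Longrightarrow> x u = y u) \<Longrightarrow> specht S x = specht S y"
  unfolding specht_def by (intro prod.cong) (auto simp: column_pairs_def)

lemma specht_nonzero: "finite S \<Longrightarrow> inj_on x S \<Longrightarrow> specht S x \<noteq> 0"
  unfolding specht_def
  by (subst prod_zero_iff) (simp, auto simp: column_pairs_def dest: inj_onD)

text \<open>Splits off the pairs containing \<open>i\<close>; by symmetry of \<open>h\<close>, the
  order of \<open>i\<close> and its partner within the column does not affect the factor.\<close>

lemma prod_column_pairs_remove:
  fixes h :: "nat \<times> nat \<Rightarrow> nat \<times> nat \<Rightarrow> 'b :: comm_monoid_mult"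
  assumes "finite S" "i \<in> S" and sym: "\<And>u v. h u v = h v u"
  shows "(\<Prod>(u, v)\<in>column_pairs S. h u v) =
    (\<Prod>(u, v)\<in>column_pairs (S - {i}). h u v) * (\<Prod>k | k \<in> S - {i} \<and> fst k = fst i. h i k)"
proof -
  define K where "K = {k \<in> S - {i}. fst k = fst i}"
  define \<phi> where "\<phi> k = (if snd i < snd k then (i, k) else (k, i))" for k
  have split: "column_pairs S = column_pairs (S - {i}) \<union> \<phi> ` K"
  proof (intro equalityI subsetI)
    fix p assume "p \<in> column_pairs S"
    then obtain u v where p: "p = (u, v)" "u \<in> S" "v \<in> S" "fst u = fst v" "snd u < snd v"
      by (auto simp: column_pairs_def)
    consider "u = i" | "v = i" | "u \<noteq> i" "v \<noteq> i" by blast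
    then show "p \<in> column_pairs (S - {i}) \<union> \<phi> ` K"
    proof cases
      case 1
      then have "p = \<phi> v" "v \<in> K" using p by (auto simp: \<phi>_def K_def)
      then show ?thesis by blast
    next
      case 2
      then have "p = \<phi> u" "u \<in> K" using p by (auto simp: \<phi>_def K_def)
      then show ?thesis by blast
    next
      case 3
      then show ?thesis using p by (auto simp: column_pairs_def)
    qed
  next
    fix p assume "p \<in> column_pairs (S - {i}) \<union> \<phi> ` K"
    then show "p \<in> column_pairs S"
    proof
      assume "p \<in> \<phi> ` K"
      then obtain k where k: "p = \<phi> k" "k \<in> S" "k \<noteq> i" "fst k = fst i" by (auto simp: K_def)
      then have "snd k \<noteq> snd i" by (metis prod_eq_iff)
      then show ?thesis using k assms(2) by (auto simp: \<phi>_def column_pairs_def)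
    qed (auto simp: column_pairs_def)
  qed
  have inj: "inj_on \<phi> K"
    by (auto simp: inj_on_def \<phi>_def K_def split: if_splits)
  have "column_pairs (S - {i}) \<inter> \<phi> ` K = {}"
    by (auto simp: column_pairs_def \<phi>_def split: if_splits)
  then have "(\<Prod>(u, v)\<in>column_pairs S. h u v) =
      (\<Prod>(u, v)\<in>column_pairs (S - {i}). h u v) * (\<Prod>(u, v)\<in>\<phi> ` K. h u v)"
    unfolding split using assms(1) by (intro prod.union_disjoint) (auto simp: K_def)
  also have "(\<Prod>(u, v)\<in>\<phi> ` K. h u v) = (\<Prod>k\<in>K. h i k)"
    using sym by (subst prod.reindex[OF inj], intro prod.cong) (simp_all add: \<phi>_def)
  finally show ?thesis unfolding K_def .
qed

text \<open>The factor by which swapping \<open>i\<close> and \<open>j\<close> changes the Specht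
  factor of the pair \<open>u\<close>, \<open>v\<close>. Unlike that factor it is symmetric in
  \<open>u\<close> and \<open>v\<close>, as \<open>prod_column_pairs_remove\<close>
  requires.\<close>

definition swap_ratio ::
    "(nat \<times> nat \<Rightarrow> 'b :: field) \<Rightarrow> nat \<times> nat \<Rightarrow> nat \<times> nat \<Rightarrow> nat \<times> nat \<Rightarrow> nat \<times> nat \<Rightarrow> 'b" where
  "swap_ratio x i j u v =
     (x (Transposition.transpose i j v) - x (Transposition.transpose i j u)) / (x v - x u)"

lemma swap_ratio_commute: "swap_ratio x i j u v = swap_ratio x i j v u"
  unfolding swap_ratio_def by (metis minus_diff_eq minus_divide_divide)

text \<open>Only pairs containing \<open>i\<close> or \<open>j\<close> change. Those with
  \<open>i\<close> are split off first, so if both boxes share a column, their common pair is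
  counted once, in the first product.\<close>

lemma specht_transpose:
  fixes x :: "nat \<times> nat \<Rightarrow> 'b :: field"
  assumes "finite S" "inj_on x S" "i \<in> S" "j \<in> S" "i \<noteq> j"
  shows "specht S (x \<circ> Transposition.transpose i j) = specht S x *
    (\<Prod>k | k \<in> S - {i} \<and> fst k = fst i. swap_ratio x i j i k) *
    (\<Prod>k | k \<in> S - {i} - {j} \<and> fst k = fst j. swap_ratio x i j j k)"
proof -
  let ?h = "swap_ratio x i j"
  have "specht S (x \<circ> Transposition.transpose i j) =
      (\<Prod>p\<in>column_pairs S. (case p of (u, v) \<Rightarrow> x v - x u) * (case p of (u, v) \<Rightarrow> ?h u v))"
    unfolding specht_def
  proof (intro prod.cong refl)
    fix p assume "p \<in> column_pairs S"
    then obtain u v where p: "p = (u, v)" "u \<in> S" "v \<in> S" "u \<noteq> v"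
      by (auto simp: column_pairs_def)
    then have "x v - x u \<noteq> 0" using assms(2) by (auto dest: inj_onD)
    then show "(case p of (u, v) \<Rightarrow> (x \<circ> Transposition.transpose i j) v - (x \<circ> Transposition.transpose i j) u)
        = (case p of (u, v) \<Rightarrow> x v - x u) * (case p of (u, v) \<Rightarrow> ?h u v)"
      using p(1) by (simp add: swap_ratio_def)
  qed
  also have "\<dots> = specht S x * (\<Prod>(u, v)\<in>column_pairs S. ?h u v)"
    by (simp add: specht_def prod.distrib)
  also have "(\<Prod>(u, v)\<in>column_pairs S. ?h u v) =
      (\<Prod>(u, v)\<in>column_pairs (S - {i} - {j}). ?h u v) *
      (\<Prod>k | k \<in> S - {i} - {j} \<and> fst k = fst j. ?h j k) *
      (\<Prod>k | k \<in> S - {i} \<and> fst k = fst i. ?h i k)"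
    using assms by (subst prod_column_pairs_remove[of S i], simp_all add: swap_ratio_commute,
        subst prod_column_pairs_remove[of "S - {i}" j], simp_all add: swap_ratio_commute)
  also have "(\<Prod>(u, v)\<in>column_pairs (S - {i} - {j}). ?h u v) = 1"
  proof (intro prod.neutral ballI)
    fix p assume "p \<in> column_pairs (S - {i} - {j})"
    then obtain u v where p: "p = (u, v)" "u \<in> S - {i} - {j}" "v \<in> S - {i} - {j}" "u \<noteq> v"
      by (auto simp: column_pairs_def)
    then have "x v - x u \<noteq> 0" using assms(2) by (auto dest: inj_onD)
    then show "(case p of (u, v) \<Rightarrow> ?h u v) = 1"
      using p by (simp add: swap_ratio_def)
  qed
  finally show ?thesis by (simp only: mult_1_left mult_ac)
qed

text \<open>The pair of \<open>i\<close> and \<open>j\<close> changes sign; for any other box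
  \<open>k\<close> of the column the ratios at \<open>i\<close> and at \<open>j\<close> are mutually
  inverse.\<close>

lemma specht_transpose_same_column:
  fixes x :: "nat \<times> nat \<Rightarrow> 'b :: field"
  assumes "finite S" "inj_on x S" "i \<in> S" "j \<in> S" "i \<noteq> j" "fst i = fst j"
  shows "specht S (x \<circ> Transposition.transpose i j) = - specht S x"
proof -
  let ?h = "swap_ratio x i j" and ?K = "{k \<in> S - {i} - {j}. fst k = fst j}"
  have "{k \<in> S - {i}. fst k = fst i} = insert j ?K"
    using assms by auto
  then have "(\<Prod>k | k \<in> S - {i} \<and> fst k = fst i. ?h i k) = ?h i j * (\<Prod>k\<in>?K. ?h i k)"
    using assms(1) by simp
  moreover have "?h i j = - 1"
  proof -
    have "x j - x i \<noteq> 0" using assms by (auto dest: inj_onD)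
    moreover have "?h i j = - ((x j - x i) / (x j - x i))"
      unfolding swap_ratio_def minus_divide_left by simp
    ultimately show ?thesis by simp
  qed
  moreover have "(\<Prod>k\<in>?K. ?h i k) * (\<Prod>k\<in>?K. ?h j k) = 1"
    unfolding prod.distrib[symmetric]
  proof (intro prod.neutral ballI)
    fix k assume k: "k \<in> ?K"
    then have "x k - x i \<noteq> 0" "x k - x j \<noteq> 0" using assms by (auto dest: inj_onD)
    then show "?h i k * ?h j k = 1"
      using k by (simp add: swap_ratio_def)
  qed
  ultimately show ?thesis
    by (simp add: specht_transpose[OF assms(1-5)] mult.assoc)
qed

text \<open>The Garnir relation. The factors of the Specht polynomial that involve \<open>v\<close> form a
  polynomial in \<open>x v\<close> of degree less than the length of column \<open>c\<close>, so the sum is its Lagrange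
  interpolation at the nodes in column \<open>c\<close>, evaluated at \<open>x v\<close>.\<close>

lemma sum_specht_transpose_column:
  fixes x :: "nat \<times> nat \<Rightarrow> 'b :: field"
  assumes S: "finite S" "inj_on x S" and v: "v \<in> S" "fst v \<noteq> c"
    and card: "card {u \<in> S. fst u = fst v} \<le> card {u \<in> S. fst u = c}"
  shows "(\<Sum>u | u \<in> S \<and> fst u = c. specht S (x \<circ> Transposition.transpose u v)) = specht S x"
proof -
  define C D where "C = {u \<in> S. fst u = c}" and "D = {u \<in> S. fst u = fst v}"
  \<comment> \<open>The product of \<open>X - x l\<close> over the other boxes of the column of
    \<open>v\<close>, scaled to the value 1 at \<open>x v\<close>. As \<open>v\<close> gives no
    factor, the degree is below \<open>card C\<close> even if both columns are equally long.\<close>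
  define p where "p = (\<Prod>l\<in>D - {v}. [:- x l / (x v - x l), 1 / (x v - x l):])"
  have fin: "finite C" "finite D" using S(1) by (auto simp: C_def D_def)
  have inj: "inj_on x C" using S(2) by (auto simp: C_def inj_on_def)
  have "v \<in> D" using v by (simp add: D_def)
  have "degree p \<le> (\<Sum>l\<in>D - {v}. degree [:- x l / (x v - x l), 1 / (x v - x l):])"
    unfolding p_def by (rule order_trans[OF degree_prod_sum_le]) (simp_all add: fin comp_def)
  also have "\<dots> \<le> (\<Sum>l\<in>D - {v}. 1)" by (intro sum_mono) simp
  also have "\<dots> < card D"
    using card_Diff1_less[OF fin(2) \<open>v \<in> D\<close>] by simp
  finally have deg: "degree p < card C" using card by (simp add: C_def D_def)
  have summand: "specht S (x \<circ> Transposition.transpose u v) =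
      specht S x * (poly p (x u) * (\<Prod>k\<in>C - {u}. (x v - x k) / (x u - x k)))" if u: "u \<in> C" for u
  proof -
    have uv: "u \<in> S" "u \<noteq> v" "fst u = c" using u v by (auto simp: C_def)
    \<comment> \<open>The pairs in column \<open>c\<close> yield the Lagrange basis polynomial of
      the node \<open>x u\<close>, evaluated at \<open>x v\<close>.\<close>
    have "(\<Prod>k | k \<in> S - {u} \<and> fst k = fst u. swap_ratio x u v u k) =
        (\<Prod>k\<in>C - {u}. (x v - x k) / (x u - x k))"
    proof (intro prod.cong)
      fix k assume "k \<in> C - {u}"
      then have "k \<noteq> u" "k \<noteq> v" using v by (auto simp: C_def)
      then show "swap_ratio x u v u k = (x v - x k) / (x u - x k)"
        by (subst swap_ratio_commute) (simp add: swap_ratio_def)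
    qed (use uv in \<open>auto simp: C_def\<close>)
    moreover have "(\<Prod>k | k \<in> S - {u} - {v} \<and> fst k = fst v. swap_ratio x u v v k) = poly p (x u)"
      unfolding p_def poly_prod
    proof (intro prod.cong)
      fix k assume "k \<in> D - {v}"
      then have "k \<noteq> u" "k \<noteq> v" using v uv by (auto simp: D_def)
      then show "swap_ratio x u v v k = poly [:- x k / (x v - x k), 1 / (x v - x k):] (x u)"
        by (subst swap_ratio_commute) (simp add: swap_ratio_def diff_divide_distrib)
    qed (use uv v in \<open>auto simp: D_def\<close>)
    ultimately show ?thesis
      using specht_transpose[OF S uv(1) v(1) uv(2)] by (simp add: mult_ac)
  qed
  have "(\<Sum>u\<in>C. specht S (x \<circ> Transposition.transpose u v)) =
      specht S x * (\<Sum>u\<in>C. poly p (x u) * (\<Prod>k\<in>C - {u}. (x v - x k) / (x u - x k)))"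
    by (simp add: summand sum_distrib_left)
  also have "\<dots> = specht S x * poly p (x v)"
    by (simp only: lagrange_interpolation[OF fin(1) inj deg, of "x v"])
  also have "poly p (x v) = 1"
    unfolding p_def poly_prod
  proof (intro prod.neutral ballI)
    fix l assume "l \<in> D - {v}"
    then have "x v - x l \<noteq> 0" using S(2) v by (auto simp: D_def dest: inj_onD)
    moreover have "poly [:- x l / (x v - x l), 1 / (x v - x l):] (x v) = (x v - x l) / (x v - x l)"
      unfolding diff_divide_distrib by simp
    ultimately show "poly [:- x l / (x v - x l), 1 / (x v - x l):] (x v) = 1" by simp
  qed
  finally show ?thesis by (simp only: C_def mult_1_right)
qed

section \<open>Young diagrams and eigenvalues\<close>

definition young_diagram :: "(nat \<times> nat) set \<Rightarrow> bool" where
  "young_diagram Y \<longleftrightarrow>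
     finite Y \<and> (\<forall>c r. (c, r) \<in> Y \<longrightarrow> (\<forall>c' \<le> c. \<forall>r' \<le> r. (c', r') \<in> Y))"

definition content_sum :: "(nat \<times> nat) set \<Rightarrow> int" where
  "content_sum Y = (\<Sum>(c, r)\<in>Y. int c - int r)"

text \<open>Each unordered pair occurs once and is grouped under its later box
  \<open>v = (c, r)\<close>. The \<open>c\<close> earlier columns contribute
  \<open>specht Y x\<close> each, the \<open>r\<close> earlier boxes of column \<open>c\<close>
  contribute \<open>- specht Y x\<close> each.\<close>

lemma sum_specht_transpose:
  fixes x :: "nat \<times> nat \<Rightarrow> real"
  assumes Y: "young_diagram Y" and inj: "inj_on x Y"
  shows "(\<Sum>(u, v) | u \<in> Y \<and> v \<in> Y \<and> (fst u < fst v \<or> fst u = fst v \<and> snd u < snd v).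
            specht Y (x \<circ> Transposition.transpose u v)) = of_int (content_sum Y) * specht Y x"
proof -
  have fin: "finite Y" using Y by (simp add: young_diagram_def)
  have closed: "(c', r') \<in> Y" if "(c, r) \<in> Y" "c' \<le> c" "r' \<le> r" for c r c' r'
    using Y that unfolding young_diagram_def by blast
  let ?s = "\<lambda>u v. specht Y (x \<circ> Transposition.transpose u v)"
  define column where "column c = {u \<in> Y. fst u = c}" for c
  have fin_col: "finite (column c)" for c using fin by (simp add: column_def)
  have earlier: "(\<Sum>u | u \<in> Y \<and> (fst u < fst v \<or> fst u = fst v \<and> snd u < snd v). ?s u v) =
      (real (fst v) - real (snd v)) * specht Y x" if v: "v \<in> Y" for v
  proof -
    obtain c r where cr: "v = (c, r)" by force
    have "{u \<in> Y. fst u < fst v \<or> fst u = fst v \<and> snd u < snd v} =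
        (\<Union>c'<c. column c') \<union> Pair c ` {..<r}"
      using closed[of c r c] v by (auto simp: cr column_def)
    then have "(\<Sum>u | u \<in> Y \<and> (fst u < fst v \<or> fst u = fst v \<and> snd u < snd v). ?s u v) =
        (\<Sum>u\<in>(\<Union>c'<c. column c'). ?s u v) + (\<Sum>u\<in>Pair c ` {..<r}. ?s u v)"
      using fin_col by (simp only:, intro sum.union_disjoint) (auto simp: column_def)
    also have "(\<Sum>u\<in>(\<Union>c'<c. column c'). ?s u v) = (\<Sum>c'<c. \<Sum>u\<in>column c'. ?s u v)"
      using fin_col by (intro sum.UNION_disjoint) (auto simp: column_def)
    also have "\<dots> = (\<Sum>c'<c. specht Y x)"
    proof (intro sum.cong refl)
      fix c' assume c': "c' \<in> {..<c}"
      \<comment> \<open>Moving boxes horizontally embeds the column of \<open>v\<close> into column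
        \<open>c'\<close>; this is the length condition of the Garnir relation.\<close>
      have "card {u \<in> Y. fst u = fst v} \<le> card {u \<in> Y. fst u = c'}"
      proof (rule card_inj_on_le[where f = "\<lambda>u. (c', snd u)"])
        show "inj_on (\<lambda>u. (c', snd u)) {u \<in> Y. fst u = fst v}"
          by (auto simp: inj_on_def)
        show "(\<lambda>u. (c', snd u)) ` {u \<in> Y. fst u = fst v} \<subseteq> {u \<in> Y. fst u = c'}"
          using closed c' by (auto simp: cr intro: less_imp_le)
      qed (use fin in auto)
      then show "(\<Sum>u\<in>column c'. ?s u v) = specht Y x"
        unfolding column_def using c'
        by (intro sum_specht_transpose_column fin inj v) (auto simp: cr)
    qed
    also have "(\<Sum>u\<in>Pair c ` {..<r}. ?s u v) = (\<Sum>u\<in>Pair c ` {..<r}. - specht Y x)"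
      using closed[of c r c] v
      by (intro sum.cong refl specht_transpose_same_column fin inj) (auto simp: cr)
    also have "\<dots> = - real r * specht Y x"
      by (simp add: card_image inj_on_def)
    also have "(\<Sum>c'<c. specht Y x) + - real r * specht Y x =
        (real (fst v) - real (snd v)) * specht Y x"
      by (simp add: cr algebra_simps)
    finally show ?thesis .
  qed
  have "(\<Sum>(u, v) | u \<in> Y \<and> v \<in> Y \<and> (fst u < fst v \<or> fst u = fst v \<and> snd u < snd v). ?s u v) =
      (\<Sum>(v, u)\<in>(SIGMA v:Y. {u \<in> Y. fst u < fst v \<or> fst u = fst v \<and> snd u < snd v}). ?s u v)"
    by (rule sum.reindex_bij_witness[of _ prod.swap prod.swap]) auto
  also have "\<dots> = (\<Sum>v\<in>Y. \<Sum>u | u \<in> Y \<and> (fst u < fst v \<or> fst u = fst v \<and> snd u < snd v). ?s u v)"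
    using fin by (subst sum.Sigma) auto
  also have "\<dots> = (\<Sum>v\<in>Y. (real (fst v) - real (snd v)) * specht Y x)"
    using earlier by (intro sum.cong) auto
  also have "\<dots> = of_int (content_sum Y) * specht Y x"
    unfolding sum_distrib_right[symmetric]
    by (simp add: content_sum_def case_prod_beta)
  finally show ?thesis .
qed

text \<open>Swapping the labels \<open>e u\<close> and \<open>e v\<close> before applying
  \<open>g\<close> amounts to swapping the boxes \<open>u\<close> and \<open>v\<close>, so the sum
  over transpositions becomes one over pairs of boxes.\<close>

lemma sum_transpositions_specht:
  fixes e :: "nat \<times> nat \<Rightarrow> nat"
  assumes Y: "young_diagram Y" and e: "bij_betw e Y {1..n}" and g: "g permutes {1..n}"
  shows "(\<Sum>t\<in>transpositions n. specht Y (\<lambda>u. real (g (t (e u))))) =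
    of_int (content_sum Y) * specht Y (\<lambda>u. real (g (e u)))"
proof -
  let ?x = "\<lambda>u. real (g (e u))"
  let ?P = "{(u, v). u \<in> Y \<and> v \<in> Y \<and> (fst u < fst v \<or> fst u = fst v \<and> snd u < snd v)}"
  define \<tau> where "\<tau> = (\<lambda>(u, v). Transposition.transpose (e u) (e v))"
  have inj_e: "inj_on e Y" and img: "e ` Y = {1..n}"
    using e by (auto simp: bij_betw_def)
  have e_mem: "e u \<in> {1..n}" if "u \<in> Y" for u using img that by blast
  have inj: "inj_on ?x Y"
    using inj_e permutes_inj[OF g] by (auto simp: inj_on_def)
  have neq: "u \<noteq> v" if "(u, v) \<in> ?P" for u v using that by auto
  have "\<tau> ` ?P = transpositions n"
  proof (intro equalityI subsetI)
    fix t assume "t \<in> \<tau> ` ?P"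
    then obtain u v where uv: "(u, v) \<in> ?P" "t = Transposition.transpose (e u) (e v)"
      by (auto simp: \<tau>_def)
    then have "e u \<noteq> e v" using inj_e neq[OF uv(1)] by (auto dest: inj_onD)
    then show "t \<in> transpositions n"
      using uv e_mem unfolding transpositions_def by blast
  next
    fix t assume "t \<in> transpositions n"
    then obtain i j where ij: "t = Transposition.transpose i j" "i \<in> e ` Y" "j \<in> e ` Y" "i \<noteq> j"
      unfolding transpositions_def img by blast
    then obtain u v where uv: "u \<in> Y" "v \<in> Y" "i = e u" "j = e v" by blast
    then have "u \<noteq> v" using ij(4) by blast
    then have "(u, v) \<in> ?P \<or> (v, u) \<in> ?P"
      using uv(1,2) by (auto simp: prod_eq_iff)
    moreover have "t = \<tau> (u, v)" "t = \<tau> (v, u)"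
      using ij(1) uv by (simp_all add: \<tau>_def transpose_commute)
    ultimately show "t \<in> \<tau> ` ?P" by blast
  qed
  moreover have "inj_on \<tau> ?P"
  proof (rule inj_onI)
    fix p q assume pq: "p \<in> ?P" "q \<in> ?P" "\<tau> p = \<tau> q"
    obtain u v where [simp]: "p = (u, v)" by (cases p)
    obtain u' v' where [simp]: "q = (u', v')" by (cases q)
    \<comment> \<open>The points moved by a transposition determine the unordered pair of boxes;
      \<open>?P\<close> contains only one of its two orderings.\<close>
    have "{e u, e v} = {z. \<tau> p z \<noteq> z}"
      using pq(1) inj_e neq[of u v] by (auto simp: \<tau>_def Transposition.transpose_def dest: inj_onD)
    also have "\<dots> = {e u', e v'}"
      using pq(2,3) inj_e neq[of u' v']
      by (auto simp: \<tau>_def Transposition.transpose_def dest: inj_onD split: if_splits)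
    finally have "e ` {u, v} = e ` {u', v'}" by simp
    then have "{u, v} = {u', v'}"
      using inj_on_image_eq_iff[OF inj_e, of "{u, v}" "{u', v'}"] pq(1,2) by auto
    then show "p = q" using pq(1,2) by (auto simp: doubleton_eq_iff)
  qed
  ultimately have "bij_betw \<tau> ?P (transpositions n)"
    by (simp only: bij_betw_def)
  then have "(\<Sum>t\<in>transpositions n. specht Y (\<lambda>u. real (g (t (e u))))) =
      (\<Sum>p\<in>?P. specht Y (\<lambda>u. real (g (\<tau> p (e u)))))"
    by (rule sum.reindex_bij_betw[symmetric])
  also have "\<dots> = (\<Sum>(u, v)\<in>?P. specht Y (?x \<circ> Transposition.transpose u v))"
  proof (intro sum.cong refl)
    fix p assume "p \<in> ?P"
    then obtain u v where p: "p = (u, v)" "u \<in> Y" "v \<in> Y" by blast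
    have "\<tau> p (e w) = e (Transposition.transpose u v w)" if "w \<in> Y" for w
      using that p inj_e by (auto simp: \<tau>_def Transposition.transpose_def dest: inj_onD)
    then show "specht Y (\<lambda>u. real (g (\<tau> p (e u)))) =
        (case p of (u, v) \<Rightarrow> specht Y (?x \<circ> Transposition.transpose u v))"
      using p(1) by (auto intro!: specht_cong)
  qed
  also have "\<dots> = of_int (content_sum Y) * specht Y ?x"
    by (rule sum_specht_transpose[OF Y inj])
  finally show ?thesis .
qed

section \<open>Eigenvectors of the transposition graph\<close>

lemma transpositions_permutes: "t \<in> transpositions n \<Longrightarrow> t permutes {1..n}"
  unfolding transpositions_def by (blast intro: permutes_swap_id)

lemma arc_transposition_graph_iff:
  assumes "g permutes {1..n}"
  shows "(g, h) \<in> parcs (transposition_graph n) \<longleftrightarrow> (\<exists>t\<in>transpositions n. h = g \<circ> t)"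
proof -
  have g: "g \<in> carrier (sym_group n)" using assms by (simp add: sym_group_def)
  have "(g, h) \<in> parcs (transposition_graph n) \<longleftrightarrow>
      h permutes {1..n} \<and> inv' g \<circ> h \<in> transpositions n"
    using g by (simp add: transposition_graph_def cayley_graph_def sym_group_inv_equality)
       (simp add: sym_group_def)
  also have "\<dots> \<longleftrightarrow> (\<exists>t\<in>transpositions n. h = g \<circ> t)"
  proof
    assume "h permutes {1..n} \<and> inv' g \<circ> h \<in> transpositions n"
    moreover have "h = g \<circ> (inv' g \<circ> h)"
      using permutes_inv_o(1)[OF assms] by (simp add: comp_assoc[symmetric])
    ultimately show "\<exists>t\<in>transpositions n. h = g \<circ> t" by blast
  next
    assume "\<exists>t\<in>transpositions n. h = g \<circ> t"
    then obtain s where s: "s \<in> transpositions n" "h = g \<circ> s" by blast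
    then have "inv' g \<circ> h = s"
      using permutes_inv_o(2)[OF assms] by (simp add: comp_assoc[symmetric])
    then show "h permutes {1..n} \<and> inv' g \<circ> h \<in> transpositions n"
      using s permutes_compose[OF transpositions_permutes[OF s(1)] assms] by simp
  qed
  finally show ?thesis .
qed

text \<open>The eigenvector lists the values \<open>f g\<close> along \<open>vs\<close>. The
  neighbours of \<open>g\<close> are the products \<open>g \<circ> t\<close>, so each row of the
  eigenvalue equation is \<open>sum_transpositions_specht\<close>. The entry at the identity is
  nonzero because the labels are distinct.\<close>

theorem eigenvalue_content_sum:
  assumes Y: "young_diagram Y" "card Y = n"
    and vs: "vertex_enumeration (transposition_graph n) vs"
  shows "eigenvalue (adjacency_matrix (transposition_graph n) vs) (of_int (content_sum Y))"
proof -
  have set_vs: "set vs = {g. g permutes {1..n}}" and dist: "distinct vs"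
    using vs by (auto simp: vertex_enumeration_def transposition_graph_def cayley_graph_def sym_group_def)
  have fin: "finite Y" using Y(1) by (simp add: young_diagram_def)
  obtain e where e: "bij_betw e Y {1..n}"
    using finite_same_card_bij[OF fin, of "{1..n}"] Y(2) by auto
  define f where "f g = specht Y (\<lambda>u. real (g (e u)))" for g :: "nat \<Rightarrow> nat"
  let ?A = "adjacency_matrix (transposition_graph n) vs"
  define w where "w = vec (length vs) (\<lambda>i. f (vs ! i))"
  have "?A *\<^sub>v w = of_int (content_sum Y) \<cdot>\<^sub>v w"
  proof (rule eq_vecI)
    fix i assume "i < dim_vec (of_int (content_sum Y) \<cdot>\<^sub>v w)"
    then have i: "i < length vs" by (simp add: w_def)
    define g where "g = vs ! i"
    have g: "g permutes {1..n}" using i set_vs nth_mem unfolding g_def by blast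
    have arcs: "{h \<in> set vs. (g, h) \<in> parcs (transposition_graph n)} = (\<lambda>t. g \<circ> t) ` transpositions n"
      using arc_transposition_graph_iff[OF g]
      by (auto simp only: set_vs mem_Collect_eq image_iff
          intro: permutes_compose[OF transpositions_permutes g])
    have inj: "inj_on (\<lambda>t. g \<circ> t) (transpositions n)"
      by (rule inj_on_subset[OF fun.inj_map[OF permutes_inj[OF g]]]) simp
    have "(?A *\<^sub>v w) $ i =
        (\<Sum>j<length vs. (if (g, vs ! j) \<in> parcs (transposition_graph n) then 1 else 0) * f (vs ! j))"
      using i by (simp add: adjacency_matrix_def w_def g_def scalar_prod_def atLeast0LessThan)
    also have "\<dots> = (\<Sum>h\<in>set vs. (if (g, h) \<in> parcs (transposition_graph n) then 1 else 0) * f h)"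
      by (rule sum.reindex_bij_betw) (rule bij_betw_nth[OF dist refl refl])
    also have "\<dots> = (\<Sum>h | h \<in> set vs \<and> (g, h) \<in> parcs (transposition_graph n). f h)"
      by (simp add: sum.inter_filter if_distrib[of "\<lambda>a. a * _"] cong: if_cong)
    also have "\<dots> = (\<Sum>t\<in>transpositions n. f (g \<circ> t))"
      unfolding arcs using inj by (simp add: sum.reindex)
    also have "\<dots> = of_int (content_sum Y) * f g"
      unfolding f_def comp_def by (rule sum_transpositions_specht[OF Y(1) e g])
    finally show "(?A *\<^sub>v w) $ i = (of_int (content_sum Y) \<cdot>\<^sub>v w) $ i"
      using i by (simp add: w_def g_def)
  qed (simp add: adjacency_matrix_def w_def)
  moreover have "w \<noteq> 0\<^sub>v (length vs)"
  proof
    assume zero: "w = 0\<^sub>v (length vs)"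
    have "id \<in> set vs" by (simp add: set_vs permutes_id)
    then obtain i where i: "i < length vs" "vs ! i = id" by (auto simp: in_set_conv_nth)
    have "f id = w $ i" using i by (simp add: w_def)
    also have "\<dots> = 0" using zero i by simp
    finally show False
      using specht_nonzero[OF fin, of "\<lambda>u. real (e u)"] e
      by (auto simp: f_def bij_betw_def inj_on_def)
  qed
  ultimately show ?thesis
    unfolding eigenvalue_def eigenvector_def
    by (intro exI[of _ w]) (auto simp: adjacency_matrix_def w_def)
qed

section \<open>Diagrams with prescribed size and content sum\<close>

text \<open>Since coordinates start at 0, \<open>A\<close> and \<open>B\<close> bound the numbers of
  columns and rows; these bounds decide which hooks can surround the diagram.\<close>

definition diagram_fits :: "int \<Rightarrow> int \<Rightarrow> int \<Rightarrow> int \<Rightarrow> bool" where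
  "diagram_fits n k A B \<longleftrightarrow>
     (\<exists>Y. young_diagram Y \<and> int (card Y) = n \<and> content_sum Y = k \<and>
          (\<forall>(c, r)\<in>Y. int c < A \<and> int r < B))"

lemma diagram_fits_mono:
  "diagram_fits n k A B \<Longrightarrow> A \<le> A' \<Longrightarrow> B \<le> B' \<Longrightarrow> diagram_fits n k A' B'"
  unfolding diagram_fits_def by fastforce

lemma diagram_fits_swap:
  assumes "diagram_fits n k A B"
  shows "diagram_fits n (- k) B A"
proof -
  obtain Y where Y: "young_diagram Y" "int (card Y) = n" "content_sum Y = k"
    "\<forall>(c, r)\<in>Y. int c < A \<and> int r < B"
    using assms unfolding diagram_fits_def by blast
  have "content_sum (prod.swap ` Y) = - content_sum Y"
    by (simp add: content_sum_def sum.reindex comp_def case_prod_beta sum_subtractf)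
  moreover have "card (prod.swap ` Y) = card Y"
    by (intro card_image) auto
  moreover have "(c, r) \<in> prod.swap ` Y \<longleftrightarrow> (r, c) \<in> Y" for c r
    by force
  then have "young_diagram (prod.swap ` Y)"
    using Y(1) unfolding young_diagram_def by simp
  ultimately show ?thesis
    unfolding diagram_fits_def using Y by (intro exI[of _ "prod.swap ` Y"]) auto
qed

text \<open>The old diagram moves one step along the diagonal, which preserves contents; the new
  first row and column contribute \<open>1 + ... + a\<close> and
  \<open>- (1 + ... + b)\<close>.\<close>

lemma diagram_fits_hook:
  assumes fits: "diagram_fits n k A B" and "A \<le> a" "B \<le> b" "0 \<le> a" "0 \<le> b"
    and content: "2 * (k' - k) = (a - b) * (a + b + 1)"
  shows "diagram_fits (n + a + b + 1) k' (a + 1) (b + 1)"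
proof -
  obtain Y where Y: "young_diagram Y" "int (card Y) = n" "content_sum Y = k"
    and box: "\<And>c r. (c, r) \<in> Y \<Longrightarrow> int c < A \<and> int r < B"
    using fits unfolding diagram_fits_def by blast
  define a' b' where "a' = nat a" and "b' = nat b"
  have ab: "a = int a'" "b = int b'" using assms by (auto simp: a'_def b'_def)
  \<comment> \<open>The corner \<open>(0, 0)\<close> belongs to \<open>column\<close>, hence the
    shifted \<open>row\<close> and the closed range in \<open>column\<close>.\<close>
  define row where "row = (\<lambda>c. (Suc c, 0::nat)) ` {..<a'}"
  define column where "column = (\<lambda>r. (0::nat, r)) ` {..b'}"
  define shift where "shift = (\<lambda>(c, r). (Suc c, Suc r)) ` Y"
  have fin: "finite row" "finite column" "finite shift"
    using Y(1) by (auto simp: row_def column_def shift_def young_diagram_def)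
  have disj: "row \<inter> column = {}" "(row \<union> column) \<inter> shift = {}"
    by (auto simp: row_def column_def shift_def)
  have inj: "inj_on (\<lambda>c. (Suc c, 0::nat)) {..<a'}" "inj_on (\<lambda>r. (0::nat, r)) {..b'}"
    "inj_on (\<lambda>(c, r). (Suc c, Suc r)) Y"
    by (auto simp: inj_on_def)
  have "card row = a'" "card column = b' + 1" "card shift = card Y"
    using inj by (simp_all add: row_def column_def shift_def card_image)
  then have card: "int (card (row \<union> column \<union> shift)) = n + a + b + 1"
    using fin disj Y(2) ab by (simp add: card_Un_disjoint)
  have triangle: "2 * (\<Sum>i\<le>m. int i) = int m * (int m + 1)" for m
    by (induction m) (auto simp: algebra_simps)
  have "content_sum (row \<union> column \<union> shift) = content_sum row + content_sum column + content_sum shift"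
    unfolding content_sum_def using fin disj by (simp add: sum.union_disjoint)
  also have "content_sum row = (\<Sum>i\<le>a'. int i)"
    unfolding content_sum_def row_def
    by (subst sum.reindex[OF inj(1)], subst sum.atMost_shift) (simp add: comp_def)
  also have "content_sum column = - (\<Sum>i\<le>b'. int i)"
    unfolding content_sum_def column_def
    by (subst sum.reindex[OF inj(2)]) (simp add: comp_def sum_negf)
  also have "content_sum shift = content_sum Y"
    unfolding content_sum_def shift_def
    by (subst sum.reindex[OF inj(3)]) (simp add: comp_def case_prod_beta)
  finally have "2 * (content_sum (row \<union> column \<union> shift) - k) = a * (a + 1) - b * (b + 1)"
    using triangle[of a'] triangle[of b'] Y(3) ab by (simp add: algebra_simps)
  also have "\<dots> = 2 * (k' - k)"
    unfolding content by (simp add: algebra_simps)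
  finally have content': "content_sum (row \<union> column \<union> shift) = k'" by simp
  have row_iff: "(c, r) \<in> row \<longleftrightarrow> c \<noteq> 0 \<and> c \<le> a' \<and> r = 0" for c r
    by (cases c) (auto simp: row_def)
  have column_iff: "(c, r) \<in> column \<longleftrightarrow> c = 0 \<and> r \<le> b'" for c r
    by (auto simp: column_def)
  have shift_iff: "(c, r) \<in> shift \<longleftrightarrow> c \<noteq> 0 \<and> r \<noteq> 0 \<and> (c - 1, r - 1) \<in> Y" for c r
    by (cases c; cases r) (auto simp: shift_def)
  have box': "c \<le> a' \<and> r \<le> b'" if "(c, r) \<in> row \<union> column \<union> shift" for c r
  proof (cases "(c, r) \<in> shift")
    case True
    then have "int (c - 1) < A" "int (r - 1) < B"
      using box[of "c - 1" "r - 1"] by (simp_all add: shift_iff)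
    then show ?thesis using assms(2,3) ab by linarith
  next
    case False
    then show ?thesis using that by (auto simp: row_iff column_iff)
  qed
  have "young_diagram (row \<union> column \<union> shift)"
    unfolding young_diagram_def
  proof (intro conjI allI impI)
    fix c r c' r'
    assume *: "(c, r) \<in> row \<union> column \<union> shift" "c' \<le> c" "r' \<le> r"
    show "(c', r') \<in> row \<union> column \<union> shift"
    \<comment> \<open>A box in row or column 0 lies on the hook by \<open>box'\<close>; any other
      one is traced back to \<open>Y\<close>.\<close>
    proof (cases "c' = 0 \<or> r' = 0")
      case True
      then show ?thesis using box'[OF *(1)] *(2,3) by (auto simp: row_iff column_iff)
    next
      case False
      then have "(c - 1, r - 1) \<in> Y"
        using * by (auto simp: row_iff column_iff shift_iff)
      moreover have "c' - 1 \<le> c - 1" "r' - 1 \<le> r - 1" using * by auto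
      ultimately have "(c' - 1, r' - 1) \<in> Y"
        using Y(1) unfolding young_diagram_def by blast
      then show ?thesis using False by (auto simp: shift_iff)
    qed
  qed (use fin in auto)
  moreover have "\<forall>(c, r)\<in>row \<union> column \<union> shift. int c < a + 1 \<and> int r < b + 1"
    using box' ab by fastforce
  ultimately show ?thesis
    unfolding diagram_fits_def using card content' by blast
qed

section \<open>Frobenius notation and the sizes settled by computation\<close>

text \<open>A partition in Frobenius notation is the list of the pairs (arm, leg) of its principal hooks,
  outermost first.\<close>

primrec frob_size :: "(int \<times> int) list \<Rightarrow> int" where
  "frob_size [] = 0"
| "frob_size (h # hs) = frob_size hs + fst h + snd h + 1"

primrec frob_content :: "(int \<times> int) list \<Rightarrow> int" where
  "frob_content [] = 0"
| "frob_content (h # hs) = frob_content hs + (fst h - snd h) * (fst h + snd h + 1) div 2"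

primrec frob_arm :: "(int \<times> int) list \<Rightarrow> int" where
  "frob_arm [] = 0"
| "frob_arm (h # hs) = fst h + 1"

primrec frob_leg :: "(int \<times> int) list \<Rightarrow> int" where
  "frob_leg [] = 0"
| "frob_leg (h # hs) = snd h + 1"

text \<open>As \<open>frob_arm\<close> and \<open>frob_leg\<close> count the corner box, arms and
  legs decrease strictly inwards; their value 0 at \<open>[]\<close> makes the innermost ones
  nonnegative.\<close>

primrec frob_nested :: "(int \<times> int) list \<Rightarrow> bool" where
  "frob_nested [] \<longleftrightarrow> True"
| "frob_nested (h # hs) \<longleftrightarrow> frob_arm hs \<le> fst h \<and> frob_leg hs \<le> snd h \<and> frob_nested hs"

lemma frob_arm_leg_nonneg: "frob_nested hs \<Longrightarrow> 0 \<le> frob_arm hs \<and> 0 \<le> frob_leg hs"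
  by (induction hs) auto

lemma frob_nested_imp_diagram_fits:
  "frob_nested hs \<Longrightarrow> diagram_fits (frob_size hs) (frob_content hs) (frob_arm hs) (frob_leg hs)"
proof (induction hs)
  case Nil
  show ?case
    unfolding diagram_fits_def
    by (rule exI[of _ "{}"]) (simp add: young_diagram_def content_sum_def)
next
  case (Cons h hs)
  obtain a b where h: "h = (a, b)" by force
  have nested: "frob_nested hs" "frob_arm hs \<le> a" "frob_leg hs \<le> b"
    using Cons.prems by (simp_all add: h)
  \<comment> \<open>The two factors have opposite parity, so the \<open>div 2\<close> in
    \<open>frob_content\<close> is exact.\<close>
  have "even ((a - b) * (a + b + 1))" by auto
  then have "2 * (frob_content (h # hs) - frob_content hs) = (a - b) * (a + b + 1)"
    by (simp add: h)
  then have "diagram_fits (frob_size hs + a + b + 1) (frob_content (h # hs)) (a + 1) (b + 1)"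
    using nested frob_arm_leg_nonneg[OF nested(1)]
    by (intro diagram_fits_hook[OF Cons.IH]) linarith+
  then show ?case by (simp add: h)
qed

text \<open>Found by a computer search for a small set of partitions such that each pair (size, content
  sum) in the lemma below is reached by adding one outer hook to one of them.\<close>

definition frobenius_cores :: "(int \<times> int) list list" where
  "frobenius_cores =
    [[(2, 2), (1, 1), (0, 0)], [(3, 3), (1, 1)], [(3, 3), (1, 0)], [(3, 2), (0, 1)],
     [(2, 1), (1, 0)], [(3, 2), (0, 0)], [(3, 2), (2, 0)], [(4, 3), (1, 1)],
     [(4, 2), (1, 0)], [(3, 1)], [(4, 2), (0, 0)], [(4, 2), (2, 0)],
     [(5, 3), (1, 2)], [(5, 3), (2, 1)], [(3, 2), (2, 1)], [(3, 2), (1, 0)],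
     [(2, 2)], [(6, 4), (1, 2), (0, 0)], [(4, 3), (3, 0)], [(2, 2), (1, 1)],
     [(4, 4), (3, 2), (2, 0)], [(3, 3), (1, 1), (0, 0)], [(1, 2), (0, 1)], [(2, 3), (0, 0)],
     [(4, 4), (2, 2), (1, 0)], [(1, 3), (0, 0)], [(2, 3), (1, 1)], [(6, 4), (2, 3), (0, 0)],
     [(4, 1), (0, 0)], [(1, 3), (0, 1)], [(2, 1), (0, 0)], [(6, 4), (3, 3)],
     [(4, 0)], [(5, 2), (1, 1)], [(5, 1)], [(5, 3)],
     [(2, 3), (0, 2)], [(4, 2), (3, 1)]]"

text \<open>The hook is determined by its size \<open>a + b + 1\<close> and the content sum
  \<open>(a - b) * (a + b + 1) / 2\<close> that it has to contribute.\<close>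

definition enclosing_hook :: "int \<Rightarrow> int \<Rightarrow> (int \<times> int) list \<Rightarrow> int \<times> int" where
  "enclosing_hook n k hs =
     (let m = n - frob_size hs; d = 2 * (k - frob_content hs) div m
      in ((m - 1 + d) div 2, (m - 1 - d) div 2))"

text \<open>The last two conditions are the invariant of the induction in
  \<open>diagram_fits_half\<close>.\<close>

definition frob_represents :: "int \<Rightarrow> int \<Rightarrow> (int \<times> int) list \<Rightarrow> bool" where
  "frob_represents n k hs \<longleftrightarrow>
     frob_nested hs \<and> frob_size hs = n \<and> frob_content hs = k \<and>
     2 * frob_arm hs \<le> n \<and> 2 * frob_leg hs \<le> n"

text \<open>Base of the induction, by evaluation; negative \<open>k\<close> follow by conjugation.
  \<open>frob_represents\<close> tests the complete list, so nothing is assumed about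
  \<open>enclosing_hook\<close>.\<close>

lemma frobenius_cores_cover:
  "\<forall>n\<in>set [19..41]. \<forall>k\<in>set [0..n].
     \<exists>hs\<in>set frobenius_cores. frob_represents n k (enclosing_hook n k hs # hs)"
  by code_simp

lemma diagram_fits_half:
  fixes n k :: int
  assumes "19 \<le> n" "\<bar>k\<bar> \<le> n"
  shows "diagram_fits n k (n div 2) (n div 2)"
  using assms
proof (induction "nat n" arbitrary: n k rule: less_induct)
  case less
  have nonneg: "diagram_fits n k (n div 2) (n div 2)" if k: "0 \<le> k" "k \<le> n" for k
  proof (cases "n \<le> 41")
    case True
    have "n \<in> set [19..41]" "k \<in> set [0..n]"
      unfolding set_upto using True less.prems(1) k by auto
    then obtain hs where hs: "frob_represents n k hs"
      using frobenius_cores_cover by blast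
    show ?thesis
      using frob_nested_imp_diagram_fits[of hs] hs
      unfolding frob_represents_def by (auto elim!: diagram_fits_mono)
  next
    case False
    \<comment> \<open>Both hooks below have \<open>2 * h + 3\<close> boxes; \<open>n = 42\<close>
      gives \<open>n' = 19\<close>. The inner diagram has sides at most \<open>h\<close>, the
      shortest leg used, and the longest new side is \<open>h + 3\<close>.\<close>
    define h n' where "h = n div 4" and "n' = n - 2 * h - 3"
    have n': "19 \<le> n'" "n' < n" "n' div 2 \<le> h" "h + 3 \<le> n div 2" "n - 2 * n' \<le> n' + 1" "0 \<le> h"
      unfolding n'_def h_def using False by presburger+
    have IH: "diagram_fits n' k (n' div 2) (n' div 2)" if "\<bar>k\<bar> \<le> n'" for k
      using less.hyps[of n' k] n' that by simp
    show ?thesis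
    proof (cases "k \<le> n'")
      case True
      \<comment> \<open>Equal arm and leg add no content.\<close>
      then have "diagram_fits (n' + (h + 1) + (h + 1) + 1) k (h + 1 + 1) (h + 1 + 1)"
        using k(1) n' by (intro diagram_fits_hook[OF IH[of k]]) auto
      then show ?thesis
        by (rule back_subst[where P = "\<lambda>n. diagram_fits n _ _ _", THEN diagram_fits_mono])
          (use n' in \<open>simp_all add: n'_def\<close>)
    next
      case False
      \<comment> \<open>With \<open>a - b = 2\<close> the hook adds its own size
        \<open>2 * h + 3\<close> to the content sum. What remains is at most \<open>n'\<close>, and
        at least \<open>- n'\<close> by \<open>n - 2 * n' \<le> n' + 1\<close>.\<close>
      have "diagram_fits (n' + (h + 2) + h + 1) k (h + 2 + 1) (h + 1)"
        using False k(2) n'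
        by (intro diagram_fits_hook[OF IH[of "k - (2 * h + 3)"]]) (auto simp: n'_def)
      then show ?thesis
        by (rule back_subst[where P = "\<lambda>n. diagram_fits n _ _ _", THEN diagram_fits_mono])
          (use n' in \<open>simp_all add: n'_def\<close>)
    qed
  qed
  show ?case
  proof (cases "0 \<le> k")
    case True
    then show ?thesis using nonneg less.prems(2) by simp
  next
    case False
    then show ?thesis using diagram_fits_swap[OF nonneg[of "- k"]] less.prems(2) by simp
  qed
qed

theorem theorem3:
  fixes n :: nat and k :: int and vs :: "(nat \<Rightarrow> nat) list"
  assumes "n \<ge> 31"
    and "- int n \<le> k" and "k \<le> int n"
    and "vertex_enumeration (transposition_graph n) vs"
  shows "eigenvalue (adjacency_matrix (transposition_graph n) vs) (real_of_int k)"
proof -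
  have "diagram_fits (int n) k (int n div 2) (int n div 2)"
    using assms(1-3) by (intro diagram_fits_half) auto
  then obtain Y where "young_diagram Y" "card Y = n" "content_sum Y = k"
    by (auto simp: diagram_fits_def)
  then show ?thesis using eigenvalue_content_sum assms(4) by blast
qed

end
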